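(* Let $n\ge 1$, let $\mathbb{V}$ be an $n$-dimensional vector space over a field $\mathbb{F}$ with basis $\mathcal{B}=\{v_1,\dots,v_n\}$. Then, up to graph isomorphism: (1) $(\mathbb{IG(V)})_{\mathrm{red}}=\Gamma^c(\mathbb{Z}_2^n)\vee K_1$; (2) $[\mathbb{UG(V)}]^{\approxeq}=\Gamma(\mathbb{Z}_2^n)\vee K_t$, where $t=|V_{12\cdots n}|=(|\mathbb{F}|-1)^n$.
   Context: All graphs are simple. For $a=a_1v_1+\dots+a_nv_n\in\mathbb{V}$, let $S_{\mathcal{B}}(a)=\{v_i\mid a_i\neq 0\}$. The nonzero component graph $\mathbb{IG(V)}$ has vertex set $\mathbb{V}\setminus\{0\}$, with distinct $a,b$ adjacent iff $S_{\mathcal{B}}(a)\cap S_{\mathcal{B}}(b)\neq\emptyset$. The nonzero component union graph $\mathbb{UG(V)}$ has vertex set $\mathbb{V}\setminus\{0\}$, with distinct $a,b$ adjacent iff $S_{\mathcal{B}}(a)\cup S_{\mathcal{B}}(b)=\mathcal{B}$. $V_{12\cdots n}=\{a\in\mathbb{V}\mid a_i\ne 0\text{ for all } i\in\{1,\dots,n\}\}$. For a graph $G$, $N(v)$ denotes the (open) neighborhood of a vertex $v$. Reduced graph $G_{\mathrm{red}}$: define $u\simeq v$ on $V(G)$ iff $u=v$, or $u$ and $v$ are adjacent with $N(u)\setminus\{v\}=N(v)\setminus\{u\}$. This is an equivalence relation; the vertices of $G_{\mathrm{red}}$ are the $\simeq$-classes, and two distinct classes $[u],[v]$ are adjacent iff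 $u$ and $v$ are adjacent in $G$. Graph $[G]^{\approxeq}$: define $u\approxeq v$ on $V(G)$ iff $N(u)=N(v)$. This is an equivalence relation; the vertices of $[G]^{\approxeq}$ are the $\approxeq$-classes, and two distinct classes are adjacent iff their representatives $u,v$ are adjacent in $G$. For a commutative ring $R$ with unity, $\Gamma(R)$ is the graph whose vertices are the nonzero zero-divisors of $R$ (possibly none), with distinct $x,y$ adjacent iff $xy=0$; $\Gamma^c(R)$ is its complement. $\mathbb{Z}_2^n$ is the direct product ring of $n$ copies of $\mathbb{Z}/2\mathbb{Z}$. The join $G\vee H$ is formed from disjoint copies of $G$ and $H$ by joining every vertex of $G$ to every vertex of $H$. $K_m$ is the complete graph on $m$ vertices ($m$ may be an infinite cardinal). *)

theory Defs
  imports "HOL-Number_Theory.Residues" "HOL-Algebra.Chinese_Remainder"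
begin

unbundle cardinal_syntax

section \<open>Simple graphs\<close>

record 'a sgraph =
  verts :: "'a set"
  edges :: "'a set set"

definition simple_graph :: "'a sgraph \<Rightarrow> bool" where
  "simple_graph G \<longleftrightarrow> (\<forall>e\<in>edges G. e \<subseteq> verts G \<and> card e = 2)"

definition adj :: "'a sgraph \<Rightarrow> 'a \<Rightarrow> 'a \<Rightarrow> bool" where
  "adj G u v \<longleftrightarrow> {u, v} \<in> edges G"

definition nbhd :: "'a sgraph \<Rightarrow> 'a \<Rightarrow> 'a set" where
  "nbhd G v = {u \<in> verts G. adj G v u}"

text \<open>Only used with relations \<open>P\<close> that are symmetric on \<open>V\<close>.\<close>

definition graph_of :: "'a set \<Rightarrow> ('a \<Rightarrow> 'a \<Rightarrow> bool) \<Rightarrow> 'a sgraph" where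
  "graph_of V P = \<lparr>verts = V, edges = {{u, v} | u v. u \<in> V \<and> v \<in> V \<and> u \<noteq> v \<and> P u v}\<rparr>"

definition graph_iso :: "'a sgraph \<Rightarrow> 'b sgraph \<Rightarrow> bool" where
  "graph_iso G H \<longleftrightarrow> (\<exists>f. bij_betw f (verts G) (verts H) \<and>
     (\<forall>u\<in>verts G. \<forall>v\<in>verts G. adj G u v \<longleftrightarrow> adj H (f u) (f v)))"

definition complement_graph :: "'a sgraph \<Rightarrow> 'a sgraph" where
  "complement_graph G = graph_of (verts G) (\<lambda>u v. \<not> adj G u v)"

text \<open>\<open>K\<^sub>\<kappa>\<close> for a cardinal \<open>\<kappa>\<close>, which as usual in HOL is a well-order relation; its field has
  cardinality \<open>\<kappa>\<close> and serves as the vertex set. In particular, \<open>complete_graph |A|\<close> lives on \<open>A\<close>.\<close>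

definition complete_graph :: "'a rel \<Rightarrow> 'a sgraph" where
  "complete_graph \<kappa> = graph_of (Field \<kappa>) (\<lambda>_ _. True)"

definition join_graph :: "'a sgraph \<Rightarrow> 'b sgraph \<Rightarrow> ('a + 'b) sgraph" where
  "join_graph G H = \<lparr>verts = verts G <+> verts H,
     edges = (\<lambda>e. Inl ` e) ` edges G \<union> (\<lambda>e. Inr ` e) ` edges H \<union>
       {{Inl u, Inr v} | u v. u \<in> verts G \<and> v \<in> verts H}\<rparr>"

text \<open>For both equivalence relations below, adjacency of distinct classes does not depend on the
  chosen representatives; see \<open>adj_reduced_graph\<close> and \<open>adj_nbhd_quotient_graph\<close>.\<close>

definition quotient_graph :: "'a sgraph \<Rightarrow> 'a rel \<Rightarrow> 'a set sgraph" where
  "quotient_graph G r = graph_of (verts G // r) (\<lambda>A B. \<exists>u\<in>A. \<exists>v\<in>B. adj G u v)"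

definition red_rel :: "'a sgraph \<Rightarrow> 'a rel" where
  "red_rel G = {(u, v). u \<in> verts G \<and> v \<in> verts G \<and>
     (u = v \<or> adj G u v \<and> nbhd G u - {v} = nbhd G v - {u})}"

definition reduced_graph :: "'a sgraph \<Rightarrow> 'a set sgraph" where
  "reduced_graph G = quotient_graph G (red_rel G)"

definition nbhd_rel :: "'a sgraph \<Rightarrow> 'a rel" where
  "nbhd_rel G = {(u, v). u \<in> verts G \<and> v \<in> verts G \<and> nbhd G u = nbhd G v}"

definition nbhd_quotient_graph :: "'a sgraph \<Rightarrow> 'a set sgraph" where
  "nbhd_quotient_graph G = quotient_graph G (nbhd_rel G)"


section \<open>Zero-divisor graphs\<close>

definition zero_divisor_graph :: "('a, 'b) ring_scheme \<Rightarrow> 'a sgraph" where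
  "zero_divisor_graph R = graph_of
     {x \<in> carrier R. x \<noteq> \<zero>\<^bsub>R\<^esub> \<and> (\<exists>y\<in>carrier R. y \<noteq> \<zero>\<^bsub>R\<^esub> \<and> x \<otimes>\<^bsub>R\<^esub> y = \<zero>\<^bsub>R\<^esub>)}
     (\<lambda>x y. x \<otimes>\<^bsub>R\<^esub> y = \<zero>\<^bsub>R\<^esub>)"

definition Z2_power :: "nat \<Rightarrow> int list ring" where
  "Z2_power n = RDirProd_list (replicate n (residue_ring 2))"


section \<open>Graphs on the nonzero vectors of a vector space with a basis\<close>

text \<open>For \<open>b \<in> B\<close>, \<open>module.representation scale B a b\<close> is the coefficient of \<open>b\<close> in the expansion
  of \<open>a\<close> with respect to the basis \<open>B\<close>.\<close>

definition basis_support ::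
    "('f::field \<Rightarrow> 'v::ab_group_add \<Rightarrow> 'v) \<Rightarrow> 'v set \<Rightarrow> 'v \<Rightarrow> 'v set" where
  "basis_support scale B a = {b \<in> B. module.representation scale B a b \<noteq> 0}"

definition component_graph ::
    "('f::field \<Rightarrow> 'v::ab_group_add \<Rightarrow> 'v) \<Rightarrow> 'v set \<Rightarrow> 'v sgraph" where
  "component_graph scale B = graph_of (UNIV - {0})
     (\<lambda>a b. basis_support scale B a \<inter> basis_support scale B b \<noteq> {})"

definition component_union_graph ::
    "('f::field \<Rightarrow> 'v::ab_group_add \<Rightarrow> 'v) \<Rightarrow> 'v set \<Rightarrow> 'v sgraph" where
  "component_union_graph scale B = graph_of (UNIV - {0})
     (\<lambda>a b. basis_support scale B a \<union> basis_support scale B b = B)"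

definition full_vectors ::
    "('f::field \<Rightarrow> 'v::ab_group_add \<Rightarrow> 'v) \<Rightarrow> 'v set \<Rightarrow> 'v set" where
  "full_vectors scale B = {a. \<forall>b\<in>B. module.representation scale B a b \<noteq> 0}"


section \<open>Well-definedness\<close>

lemma adj_sym: "adj G u v \<longleftrightarrow> adj G v u"
  by (simp add: adj_def insert_commute)

lemma simple_graph_adjD:
  assumes "simple_graph G" "adj G u v"
  shows "u \<in> verts G" "v \<in> verts G" "u \<noteq> v"
  using assms by (auto simp: simple_graph_def adj_def)

lemma verts_graph_of [simp]: "verts (graph_of V P) = V"
  by (simp add: graph_of_def)

lemma simple_graph_graph_of: "simple_graph (graph_of V P)"
  by (auto simp: simple_graph_def graph_of_def)

lemma adj_graph_of:
  assumes "\<And>u v. u \<in> V \<Longrightarrow> v \<in> V \<Longrightarrow> P u v \<Longrightarrow> P v u"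
  shows "adj (graph_of V P) u v \<longleftrightarrow> u \<in> V \<and> v \<in> V \<and> u \<noteq> v \<and> P u v"
  using assms by (auto simp: adj_def graph_of_def doubleton_eq_iff)

lemma equiv_nbhd_rel: "equiv (verts G) (nbhd_rel G)"
  by (intro equivI) (auto simp: nbhd_rel_def refl_on_def sym_def trans_def)

lemma equiv_red_rel:
  assumes "simple_graph G"
  shows "equiv (verts G) (red_rel G)"
proof (intro equivI)
  have char: "(u, v) \<in> red_rel G \<longleftrightarrow>
      u \<in> verts G \<and> v \<in> verts G \<and> insert u (nbhd G u) = insert v (nbhd G v)" for u v
  proof -
    have "u \<notin> nbhd G u" "v \<notin> nbhd G v"
      using simple_graph_adjD(3)[OF assms, of u u] simple_graph_adjD(3)[OF assms, of v v]
      by (auto simp: nbhd_def)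
    moreover have "adj G u v \<longleftrightarrow> v \<in> nbhd G u" "adj G u v \<longleftrightarrow> u \<in> nbhd G v"
      using simple_graph_adjD[OF assms] adj_sym[of G] by (auto simp: nbhd_def)
    ultimately show ?thesis
      unfolding red_rel_def by auto
  qed
  show "refl_on (verts G) (red_rel G)" by (auto simp: refl_on_def char)
  show "sym (red_rel G)" by (auto simp: sym_def char)
  show "trans (red_rel G)" by (auto simp: trans_def char)
  show "red_rel G \<subseteq> verts G \<times> verts G" by (auto simp: char)
qed

lemma adj_quotient_graph:
  "adj (quotient_graph G r) A B \<longleftrightarrow>
     A \<in> verts G // r \<and> B \<in> verts G // r \<and> A \<noteq> B \<and> (\<exists>u\<in>A. \<exists>v\<in>B. adj G u v)"
  unfolding quotient_graph_def
  by (rule adj_graph_of) (use adj_sym[of G] in blast)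

lemma adj_reduced_graph:
  assumes "simple_graph G" "u \<in> verts G" "v \<in> verts G"
    and "red_rel G `` {u} \<noteq> red_rel G `` {v}"
  shows "adj (reduced_graph G) (red_rel G `` {u}) (red_rel G `` {v}) \<longleftrightarrow> adj G u v"
proof -
  note eq = equiv_red_rel[OF assms(1)]
  have step: "adj G x' y" if "adj G x y" "(x, x') \<in> red_rel G" "(x', y) \<notin> red_rel G" for x x' y
  proof (cases "x = x'")
    case False
    with that(2) have "nbhd G x - {x'} = nbhd G x' - {x}" by (auto simp: red_rel_def)
    moreover have "y \<in> nbhd G x" using that(1) simple_graph_adjD[OF assms(1)] by (auto simp: nbhd_def)
    moreover have "y \<noteq> x'" using that(2,3) by (auto simp: red_rel_def)
    ultimately show ?thesis by (auto simp: nbhd_def)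
  qed (use that in simp)
  have uv: "(u, v) \<notin> red_rel G" using assms(2-4) eq by (simp add: eq_equiv_class_iff)
  have sym: "sym (red_rel G)" and trans: "trans (red_rel G)"
    using eq by (auto simp: equiv_def)
  have "adj G u v" if "(u, x) \<in> red_rel G" "(v, y) \<in> red_rel G" "adj G x y" for x y
  proof -
    have "(u, y) \<notin> red_rel G" using uv that(2) sym trans by (meson symD transD)
    then have "adj G u y" using step[OF that(3)] that(1) sym by (meson symD)
    then have "adj G y u" by (simp add: adj_sym)
    moreover have "(v, u) \<notin> red_rel G" using uv sym by (meson symD)
    ultimately have "adj G v u" using step that(2) sym by (meson symD)
    then show ?thesis by (simp add: adj_sym)
  qed
  then have "(\<exists>x\<in>red_rel G `` {u}. \<exists>y\<in>red_rel G `` {v}. adj G x y) \<longleftrightarrow> adj G u v"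
    using equiv_class_self[OF eq assms(2)] equiv_class_self[OF eq assms(3)]
    by (metis Image_singleton_iff)
  with assms(2-4) show ?thesis
    unfolding reduced_graph_def adj_quotient_graph
    by (simp add: quotientI)
qed

lemma adj_nbhd_quotient_graph:
  assumes "u \<in> verts G" "v \<in> verts G"
    and "nbhd_rel G `` {u} \<noteq> nbhd_rel G `` {v}"
  shows "adj (nbhd_quotient_graph G) (nbhd_rel G `` {u}) (nbhd_rel G `` {v}) \<longleftrightarrow> adj G u v"
proof -
  have "adj G u v" if "(u, x) \<in> nbhd_rel G" "(v, y) \<in> nbhd_rel G" "adj G x y" for x y
  proof -
    have "y \<in> nbhd G u" using that by (auto simp: nbhd_rel_def nbhd_def)
    then have "u \<in> nbhd G y" using assms(1) by (auto simp: nbhd_def adj_sym)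
    then have "u \<in> nbhd G v" using that by (auto simp: nbhd_rel_def)
    then show ?thesis by (auto simp: nbhd_def adj_sym)
  qed
  then have "(\<exists>x\<in>nbhd_rel G `` {u}. \<exists>y\<in>nbhd_rel G `` {v}. adj G x y) \<longleftrightarrow> adj G u v"
    using equiv_class_self[OF equiv_nbhd_rel assms(1)] equiv_class_self[OF equiv_nbhd_rel assms(2)]
    by (metis Image_singleton_iff)
  with assms show ?thesis
    unfolding nbhd_quotient_graph_def adj_quotient_graph
    by (simp add: quotientI)
qed

end

theory Submission
  imports Defs
begin

text \<open>In the component graph, two vectors are identified exactly if they have the same support;
  the class of full support is adjacent to all others and yields \<open>K\<^sub>1\<close>. A proper nonempty support
  is the support of a nonzero zero divisor of \<open>\<int>\<^sub>2\<^sup>n\<close>, and meeting supports means nonzero product.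
  In the union graph, vectors of full support are adjacent to everything but themselves, so
  their classes are singletons; vectors of the same proper support are not adjacent to each other
  and are identified. Passing to complements turns \<open>S \<union> T = B\<close> into disjointness, that is, into
  zero product.\<close>

section \<open>Adjacency in complements, complete graphs and joins\<close>

lemma adj_complement_graph:
  "adj (complement_graph G) u v \<longleftrightarrow> u \<in> verts G \<and> v \<in> verts G \<and> u \<noteq> v \<and> \<not> adj G u v"
  unfolding complement_graph_def by (rule adj_graph_of) (simp add: adj_sym)

lemma verts_complement_graph [simp]: "verts (complement_graph G) = verts G"
  by (simp add: complement_graph_def)

lemma verts_complete_graph [simp]: "verts (complete_graph r) = Field r"
  by (simp add: complete_graph_def)

lemma adj_complete_graph:
  "adj (complete_graph r) u v \<longleftrightarrow> u \<in> Field r \<and> v \<in> Field r \<and> u \<noteq> v"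
  unfolding complete_graph_def by (subst adj_graph_of) auto

lemma verts_join_graph [simp]: "verts (join_graph G H) = verts G <+> verts H"
  by (simp add: join_graph_def)

lemma adj_join_graph [simp]:
  "adj (join_graph G H) (Inl u) (Inl v) \<longleftrightarrow> adj G u v"
  "adj (join_graph G H) (Inr x) (Inr y) \<longleftrightarrow> adj H x y"
  "adj (join_graph G H) (Inl u) (Inr y) \<longleftrightarrow> u \<in> verts G \<and> y \<in> verts H"
  "adj (join_graph G H) (Inr y) (Inl u) \<longleftrightarrow> u \<in> verts G \<and> y \<in> verts H"
proof -
  \<comment> \<open>Taking images under an injection is injective on sets, so an edge inside one
    summand of the join comes from exactly one edge of that summand.\<close>
  have inl: "{Inl u, Inl v} = Inl ` e \<longleftrightarrow> {u, v} = e" for u v and e :: "'a set"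
    using inj_image_eq_iff[of Inl "{u, v}" e] by simp
  have inr: "{Inr u, Inr v} = Inr ` e \<longleftrightarrow> {u, v} = e" for u v and e :: "'b set"
    using inj_image_eq_iff[of Inr "{u, v}" e] by simp
  show "adj (join_graph G H) (Inl u) (Inl v) \<longleftrightarrow> adj G u v"
    by (auto simp: adj_def join_graph_def inl image_iff doubleton_eq_iff)
  show "adj (join_graph G H) (Inr x) (Inr y) \<longleftrightarrow> adj H x y"
    by (auto simp: adj_def join_graph_def inr image_iff doubleton_eq_iff)
  show "adj (join_graph G H) (Inl u) (Inr y) \<longleftrightarrow> u \<in> verts G \<and> y \<in> verts H"
    by (auto simp: adj_def join_graph_def doubleton_eq_iff)
  then show "adj (join_graph G H) (Inr y) (Inl u) \<longleftrightarrow> u \<in> verts G \<and> y \<in> verts H"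
    by (simp add: adj_sym)
qed

section \<open>Isomorphisms out of quotient graphs\<close>

text \<open>A map \<open>f\<close> onto the vertices of \<open>H\<close> whose fibres are the
  classes of \<open>r\<close> descends to a bijection on classes. Adjacency is compared only across
  different values of \<open>f\<close>; since the right side depends on these values alone,
  adjacency in \<open>G\<close> between two different classes is independent of representatives.
  Equal classes are covered by \<open>irrefl\<close>, as a quotient graph has no loops.\<close>

lemma graph_iso_quotientI:
  assumes r: "equiv (verts G) r"
    and f: "f ` verts G = verts H"
    and kernel: "\<And>u v. u \<in> verts G \<Longrightarrow> v \<in> verts G \<Longrightarrow> (u, v) \<in> r \<longleftrightarrow> f u = f v"
    and adj: "\<And>u v. u \<in> verts G \<Longrightarrow> v \<in> verts G \<Longrightarrow> f u \<noteq> f v \<Longrightarrow> adj G u v \<longleftrightarrow> adj H (f u) (f v)"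
    and irrefl: "\<And>x. \<not> adj H x x"
  shows "graph_iso (quotient_graph G r) H"
proof -
  \<comment> \<open>The image of a class under \<open>f\<close> is a singleton, so
    \<open>the_elem\<close> yields the common value without choosing a representative.\<close>
  define F where "F A = the_elem (f ` A)" for A
  have class_sub: "A \<subseteq> verts G" if "A \<in> verts G // r" for A
    using that r by (meson in_quotient_imp_subset)
  have F: "F A = f u" if "A \<in> verts G // r" "u \<in> A" for A u
  proof -
    have "f v = f u" if "v \<in> A" for v
      using kernel[of v u] quotient_eq_iff[OF r] class_sub \<open>A \<in> verts G // r\<close> \<open>u \<in> A\<close> that
      by blast
    then have "f ` A = {f u}" using \<open>u \<in> A\<close> by blast
    then show ?thesis by (simp add: F_def)
  qed
  have rep: "\<exists>u\<in>verts G. u \<in> A \<and> A = r `` {u} \<and> F A = f u" if "A \<in> verts G // r" for A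
    using that F[OF that] equiv_class_self[OF r] by (auto elim!: quotientE)
  have "inj_on F (verts G // r)"
    using rep kernel equiv_class_eq_iff[OF r] by (intro inj_onI) metis
  moreover have "F ` (verts G // r) = verts H"
  proof
    show "F ` (verts G // r) \<subseteq> verts H" using rep f by force
    show "verts H \<subseteq> F ` (verts G // r)"
    proof
      fix x assume "x \<in> verts H"
      then obtain u where "u \<in> verts G" "x = f u" using f by auto
      then have "x = F (r `` {u})" "r `` {u} \<in> verts G // r"
        using F[of "r `` {u}" u] equiv_class_self[OF r] by (auto simp: quotientI)
      then show "x \<in> F ` (verts G // r)" by blast
    qed
  qed
  moreover have "adj (quotient_graph G r) A A' \<longleftrightarrow> adj H (F A) (F A')"
    if A: "A \<in> verts G // r" "A' \<in> verts G // r" for A A'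
  proof (cases "A = A'")
    case True
    then show ?thesis using irrefl by (simp add: adj_quotient_graph)
  next
    case False
    then have "F A \<noteq> F A'"
      using \<open>inj_on F (verts G // r)\<close> A by (auto dest: inj_onD)
    \<comment> \<open>This holds for all representatives, so a single pair decides the existential
      in \<open>adj_quotient_graph\<close>.\<close>
    then have "adj G u v \<longleftrightarrow> adj H (F A) (F A')" if "u \<in> A" "v \<in> A'" for u v
      using that F A adj[of u v] class_sub by (metis subsetD)
    moreover obtain u v where "u \<in> A" "v \<in> A'" using rep A by meson
    ultimately show ?thesis using A False by (auto simp: adj_quotient_graph)
  qed
  ultimately show ?thesis
    unfolding graph_iso_def bij_betw_def by (auto simp: quotient_graph_def)
qed

section \<open>Subsets of a finite set as elements of the ring
  \<open>\<int>\<^sub>2\<^sup>n\<close>\<close>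

text \<open>The list \<open>bs\<close> fixes which coordinate belongs to which element. Elements of
  \<open>S\<close> outside the list leave no trace, hence the intersections with
  \<open>set bs\<close> in \<open>indicator_word_eq_iff\<close>.\<close>

definition indicator_word :: "'b list \<Rightarrow> 'b set \<Rightarrow> int list" where
  "indicator_word bs S = map (\<lambda>b. of_bool (b \<in> S)) bs"

lemma carrier_Z2_power:
  "carrier (Z2_power n) = {xs. length xs = n \<and> set xs \<subseteq> {0, 1}}"
proof -
  have "carrier (residue_ring 2) = {0, 1}" by (auto simp: residue_ring_def)
  then have res: "carrier (replicate n (residue_ring 2) ! i) = {0, 1}" if "i < n" for i
    using that by simp
  show ?thesis
  proof (intro equalityI subsetI)
    fix xs assume "xs \<in> carrier (Z2_power n)"
    note xs = RDirProd_list_carrier_mem[OF this[unfolded Z2_power_def]]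
    show "xs \<in> {xs. length xs = n \<and> set xs \<subseteq> {0, 1}}"
      using xs res by (fastforce simp: in_set_conv_nth)
  next
    fix xs :: "int list" assume "xs \<in> {xs. length xs = n \<and> set xs \<subseteq> {0, 1}}"
    then have "length xs = n" "set xs \<subseteq> {0, 1}" by simp_all
    then have "xs ! i \<in> {0, 1}" if "i < n" for i
      using that nth_mem[of i xs] by blast
    with \<open>length xs = n\<close> show "xs \<in> carrier (Z2_power n)"
      unfolding Z2_power_def using res by (intro RDirProd_list_carrier_memI) auto
  qed
qed

lemma indicator_word_carrier: "indicator_word bs S \<in> carrier (Z2_power (length bs))"
  by (auto simp: carrier_Z2_power indicator_word_def)

lemma indicator_word_surj:
  assumes "distinct bs" "xs \<in> carrier (Z2_power (length bs))"
  shows "\<exists>S\<subseteq>set bs. xs = indicator_word bs S"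
proof (intro exI conjI)
  let ?S = "{bs ! i | i. i < length bs \<and> xs ! i = 1}"
  show "?S \<subseteq> set bs" by auto
  have "length xs = length bs" "set xs \<subseteq> {0, 1}"
    using assms(2) by (simp_all add: carrier_Z2_power)
  then have "xs ! i = 0 \<or> xs ! i = 1" if "i < length bs" for i
    using that nth_mem[of i xs] by fastforce
  \<comment> \<open>Distinctness enters here: an entry of \<open>bs\<close> determines its position,
    so membership in the witness can be read off from that coordinate alone.\<close>
  moreover have "bs ! i \<in> ?S \<longleftrightarrow> xs ! i = 1" if "i < length bs" for i
    using that assms(1) by (auto simp: nth_eq_iff_index_eq)
  ultimately show "xs = indicator_word bs ?S"
    using \<open>length xs = length bs\<close>
    by (intro nth_equalityI) (force simp: indicator_word_def)+
qed

lemma indicator_word_eq_iff: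
  "indicator_word bs S = indicator_word bs T \<longleftrightarrow> S \<inter> set bs = T \<inter> set bs"
  by (auto simp: indicator_word_def of_bool_eq_iff)

lemma zero_Z2_power: "\<zero>\<^bsub>Z2_power (length bs)\<^esub> = indicator_word bs {}"
  unfolding Z2_power_def indicator_word_def
  by (induction bs) (simp_all add: RDirProd_list_zero' residue_ring_def monoid.defs)

text \<open>In each coordinate the product of two indicator values is the indicator value of the
  intersection. The induction splits off the first coordinate with the ring homomorphism that conses
  a head onto a tail.\<close>

lemma indicator_word_mult:
  "indicator_word bs S \<otimes>\<^bsub>Z2_power (length bs)\<^esub> indicator_word bs T = indicator_word bs (S \<inter> T)"
proof (induction bs)
  case Nil
  then show ?case by (simp add: Z2_power_def indicator_word_def monoid.defs)
next
  case (Cons b bs)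
  have "(x # xs) \<otimes>\<^bsub>Z2_power (Suc n)\<^esub> (y # ys) = (x * y mod 2) # (xs \<otimes>\<^bsub>Z2_power n\<^esub> ys)"
    if "x \<in> {0, 1}" "y \<in> {0, 1}" "xs \<in> carrier (Z2_power n)" "ys \<in> carrier (Z2_power n)"
    for x y :: int and xs ys n
    using ring_hom_mult[OF RDirProd_list_hom1[of "residue_ring 2" "replicate n (residue_ring 2)"],
        of "(x, xs)" "(y, ys)"] that
    by (auto simp: Z2_power_def RDirProd_carrier RDirProd_def DirProd_def monoid.defs residue_ring_def)
  then show ?case
    using Cons indicator_word_carrier[of bs] by (simp add: indicator_word_def)
qed

text \<open>Two nonzero words with zero product belong to disjoint nonempty sets, so neither set is
  everything. Conversely, the complement of a proper subset gives a nonzero word that annihilates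
  it.\<close>

lemma verts_zero_divisor_graph_Z2_power:
  assumes "distinct bs"
  shows "verts (zero_divisor_graph (Z2_power (length bs))) =
    indicator_word bs ` {S. S \<subseteq> set bs \<and> S \<noteq> {} \<and> S \<noteq> set bs}" (is "?L = ?R")
proof
  show "?L \<subseteq> ?R"
  proof
    fix xs assume "xs \<in> ?L"
    then obtain ys where xs: "xs \<in> carrier (Z2_power (length bs))" "xs \<noteq> indicator_word bs {}"
      and ys: "ys \<in> carrier (Z2_power (length bs))" "ys \<noteq> indicator_word bs {}"
      and 0: "xs \<otimes>\<^bsub>Z2_power (length bs)\<^esub> ys = indicator_word bs {}"
      by (auto simp: zero_divisor_graph_def zero_Z2_power)
    obtain S where S: "S \<subseteq> set bs" "xs = indicator_word bs S"
      using indicator_word_surj[OF assms xs(1)] by blast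
    obtain T where T: "T \<subseteq> set bs" "ys = indicator_word bs T"
      using indicator_word_surj[OF assms ys(1)] by blast
    have "S \<noteq> {}" "T \<noteq> {}" "S \<inter> T = {}"
      using xs(2) ys(2) 0 S T by (auto simp: indicator_word_mult indicator_word_eq_iff)
    then show "xs \<in> ?R" using S T by auto
  qed
  show "?R \<subseteq> ?L"
  proof
    fix xs assume "xs \<in> ?R"
    then obtain S where S: "S \<subseteq> set bs" "S \<noteq> {}" "S \<noteq> set bs" "xs = indicator_word bs S" by auto
    have "indicator_word bs (set bs - S) \<noteq> indicator_word bs {}"
      "xs \<otimes>\<^bsub>Z2_power (length bs)\<^esub> indicator_word bs (set bs - S) = indicator_word bs {}"
      using S by (auto simp: indicator_word_mult indicator_word_eq_iff)
    moreover have "xs \<noteq> indicator_word bs {}"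
      using S by (auto simp: indicator_word_eq_iff)
    ultimately show "xs \<in> ?L"
      using S indicator_word_carrier[of bs] by (auto simp: zero_divisor_graph_def zero_Z2_power)
  qed
qed

lemma adj_zero_divisor_graph_Z2_power:
  assumes "distinct bs"
    and S: "S \<subseteq> set bs" "S \<noteq> {}" "S \<noteq> set bs"
    and T: "T \<subseteq> set bs" "T \<noteq> {}" "T \<noteq> set bs"
  shows "adj (zero_divisor_graph (Z2_power (length bs))) (indicator_word bs S) (indicator_word bs T)
    \<longleftrightarrow> S \<inter> T = {}"
proof -
  let ?R = "Z2_power (length bs)"
  \<comment> \<open>\<open>adj_graph_of\<close> asks for a symmetric relation; multiplication
    commutes because all elements are indicator words and intersection commutes.\<close>
  have comm: "y \<otimes>\<^bsub>?R\<^esub> x = x \<otimes>\<^bsub>?R\<^esub> y" if "x \<in> carrier ?R" "y \<in> carrier ?R" for x y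
    using indicator_word_surj[OF assms(1)] that by (metis indicator_word_mult Int_commute)
  have "adj (zero_divisor_graph ?R) x y \<longleftrightarrow> x \<in> verts (zero_divisor_graph ?R) \<and>
      y \<in> verts (zero_divisor_graph ?R) \<and> x \<noteq> y \<and> x \<otimes>\<^bsub>?R\<^esub> y = \<zero>\<^bsub>?R\<^esub>" for x y
    unfolding zero_divisor_graph_def verts_graph_of
    by (rule adj_graph_of) (use comm in auto)
  then show ?thesis
    unfolding verts_zero_divisor_graph_Z2_power[OF assms(1)] using S T
    by (auto simp: indicator_word_mult indicator_word_eq_iff zero_Z2_power)
qed

section \<open>The component graph and the component union graph\<close>

lemma verts_component_graph [simp]: "verts (component_graph scale B) = UNIV - {0}"
  by (simp add: component_graph_def)

lemma verts_component_union_graph [simp]: "verts (component_union_graph scale B) = UNIV - {0}"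
  by (simp add: component_union_graph_def)

lemma adj_component_graph:
  "adj (component_graph scale B) a b \<longleftrightarrow>
    a \<noteq> 0 \<and> b \<noteq> 0 \<and> a \<noteq> b \<and> basis_support scale B a \<inter> basis_support scale B b \<noteq> {}"
  unfolding component_graph_def by (subst adj_graph_of) auto

lemma adj_component_union_graph:
  "adj (component_union_graph scale B) a b \<longleftrightarrow>
    a \<noteq> 0 \<and> b \<noteq> 0 \<and> a \<noteq> b \<and> basis_support scale B a \<union> basis_support scale B b = B"
  unfolding component_union_graph_def by (subst adj_graph_of) auto

lemma basis_support_subset: "basis_support scale B a \<subseteq> B"
  by (auto simp: basis_support_def)

lemma full_vectors_iff: "a \<in> full_vectors scale B \<longleftrightarrow> basis_support scale B a = B"
  by (auto simp: full_vectors_def basis_support_def)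

section \<open>Supports and coordinates with respect to a finite basis\<close>

context finite_dimensional_vector_space
begin

text \<open>Coefficients are unique by independence. Since \<open>representation\<close> is a total
  function that vanishes off the basis, \<open>g\<close> has to do so too for an equality of
  functions.\<close>

lemma representation_Basis_sum:
  fixes g :: "'b \<Rightarrow> 'a"
  assumes "\<And>b. b \<notin> Basis \<Longrightarrow> g b = 0"
  shows "representation Basis (\<Sum>b\<in>Basis. g b *s b) = g"
proof (rule representation_eqI[OF independent_Basis])
  show "finite {b. g b \<noteq> 0}"
    using assms by (intro finite_subset[OF _ finite_Basis]) auto
  show "(\<Sum>b | g b \<noteq> 0. g b *s b) = (\<Sum>b\<in>Basis. g b *s b)"
    using assms by (intro sum.mono_neutral_left finite_Basis) auto
qed (use assms in \<open>auto simp: span_Basis\<close>)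

lemma representation_Basis_inj:
  assumes "\<And>b. b \<in> Basis \<Longrightarrow> representation Basis u b = representation Basis v b"
  shows "u = v"
proof -
  have "(\<Sum>b\<in>Basis. representation Basis w b *s b) = w" for w
    by (rule sum_representation_eq) (auto simp: independent_Basis finite_Basis span_Basis)
  then show ?thesis using assms by (metis (no_types, lifting) sum.cong)
qed

lemma basis_support_empty_iff: "basis_support scale Basis a = {} \<longleftrightarrow> a = 0"
proof -
  have "a = 0" if "\<forall>b\<in>Basis. representation Basis a b = 0"
    using that by (intro representation_Basis_inj) (simp add: representation_zero)
  then show ?thesis by (auto simp: basis_support_def representation_zero)
qed

lemma ex_basis_support:
  assumes "S \<subseteq> Basis"
  shows "\<exists>a. basis_support scale Basis a = S"
proof
  \<comment> \<open>The witness is the sum of the basis vectors in \<open>S\<close>.\<close>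
  show "basis_support scale Basis (\<Sum>b\<in>Basis. (if b \<in> S then 1 else 0) *s b) = S"
    using assms by (subst basis_support_def, subst representation_Basis_sum) auto
qed

text \<open>A vector of full support amounts to a free choice of a nonzero scalar for each basis
  vector. The restriction is there because members of \<open>Func\<close> are
  \<open>undefined\<close> off their domain, whereas \<open>representation\<close> is 0
  there.\<close>

lemma bij_betw_full_vectors:
  "bij_betw (\<lambda>a. restrict (representation Basis a) Basis) (full_vectors scale Basis)
     (Func Basis (UNIV - {0}))"
proof (rule bij_betwI')
  fix u v
  show "(restrict (representation Basis u) Basis = restrict (representation Basis v) Basis) = (u = v)"
    using representation_Basis_inj[of u v] by (metis restrict_apply')
next
  fix u assume "u \<in> full_vectors scale Basis"
  then show "restrict (representation Basis u) Basis \<in> Func Basis (UNIV - {0})"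
    by (auto simp: full_vectors_def Func_def)
next
  fix g :: "'b \<Rightarrow> 'a" assume g: "g \<in> Func Basis (UNIV - {0})"
  \<comment> \<open>The value \<open>undefined\<close> off the basis is replaced by 0, as
    \<open>representation_Basis_sum\<close> requires.\<close>
  let ?g = "\<lambda>b. if b \<in> Basis then g b else 0"
  let ?a = "\<Sum>b\<in>Basis. ?g b *s b"
  have a: "representation Basis ?a = ?g"
    by (rule representation_Basis_sum) simp
  have "g = restrict ?g Basis" using g by (auto simp: Func_def)
  moreover have "?a \<in> full_vectors scale Basis"
    unfolding full_vectors_def mem_Collect_eq a using g by (auto simp: Func_def)
  ultimately show "\<exists>a\<in>full_vectors scale Basis. g = restrict (representation Basis a) Basis"
    using a by (intro bexI[of _ ?a]) simp_all
qed

text \<open>Cardinal exponentiation is defined through \<open>Func\<close>, so the coordinate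
  bijection gives the count over finite and infinite fields alike; removing 0 from the field
  accounts for the subtracted 1.\<close>

lemma full_vectors_ordIso:
  "|full_vectors scale Basis| =o |UNIV - {0::'a}| ^c |Basis|"
  using bij_betw_full_vectors by (auto simp: cexp_def Field_card_of card_of_ordIso[symmetric])

lemma card_full_vectors:
  assumes "finite (UNIV :: 'a set)"
  shows "card (full_vectors scale Basis) = (card (UNIV :: 'a set) - 1) ^ card Basis"
proof -
  have "Func Basis (UNIV - {0::'a}) = Basis \<rightarrow>\<^sub>E UNIV - {0}"
    by (auto simp: Func_def PiE_def Pi_def extensional_def)
  then show ?thesis
    using bij_betw_same_card[OF bij_betw_full_vectors] assms
    by (simp add: card_PiE finite_Basis)
qed

section \<open>The equivalence classes in terms of supports\<close>

text \<open>Vectors with the same nonempty support are adjacent and meet the same supports.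
  Conversely, a vector \<open>c\<close> supported on a single basis vector \<open>x\<close> tests
  membership: it meets exactly the supports that contain \<open>x\<close>.\<close>

lemma red_rel_component_graph_iff:
  assumes "a \<noteq> 0" "b \<noteq> 0"
  shows "(a, b) \<in> red_rel (component_graph scale Basis) \<longleftrightarrow>
    basis_support scale Basis a = basis_support scale Basis b"
proof
  assume eq: "basis_support scale Basis a = basis_support scale Basis b"
  then have "basis_support scale Basis a \<inter> basis_support scale Basis b \<noteq> {}"
    using assms by (simp add: basis_support_empty_iff)
  then show "(a, b) \<in> red_rel (component_graph scale Basis)"
    using assms eq by (auto simp: red_rel_def nbhd_def adj_component_graph)
next
  have sub: "basis_support scale Basis u \<subseteq> basis_support scale Basis v"
    if uv: "(u, v) \<in> red_rel (component_graph scale Basis)" for u v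
  proof
    fix x assume x: "x \<in> basis_support scale Basis u"
    then obtain c where c: "basis_support scale Basis c = {x}"
      using ex_basis_support[of "{x}"] by (auto simp: basis_support_def)
    then have "c \<noteq> 0" using basis_support_empty_iff by force
    show "x \<in> basis_support scale Basis v"
    proof (cases "u = v \<or> c = v")
      case False
      then have nb: "nbhd (component_graph scale Basis) u - {v} =
          nbhd (component_graph scale Basis) v - {u}" and "u \<noteq> 0" "v \<noteq> 0"
          "adj (component_graph scale Basis) u v"
        using uv by (auto simp: red_rel_def)
      \<comment> \<open>The compared neighbourhoods omit \<open>u\<close> and \<open>v\<close>. If
        the test vector is \<open>u\<close> itself, the adjacency of \<open>u\<close> and
        \<open>v\<close> puts \<open>x\<close> into the support of \<open>v\<close>.\<close>
      show ?thesis
      proof (cases "c = u")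
        case True
        then show ?thesis
          using c \<open>adj _ u v\<close> by (auto simp: adj_component_graph)
      next
        case False
        then have "c \<in> nbhd (component_graph scale Basis) u - {v}"
          using x c \<open>c \<noteq> 0\<close> \<open>u \<noteq> 0\<close> \<open>\<not> (u = v \<or> c = v)\<close> by (auto simp: nbhd_def adj_component_graph)
        then have "c \<in> nbhd (component_graph scale Basis) v" using nb by blast
        then show ?thesis using c by (simp add: nbhd_def adj_component_graph)
      qed
    qed (use x c in auto)
  qed
  assume ab: "(a, b) \<in> red_rel (component_graph scale Basis)"
  then have "(b, a) \<in> red_rel (component_graph scale Basis)"
    using adj_sym by (fastforce simp: red_rel_def)
  with ab sub show "basis_support scale Basis a = basis_support scale Basis b" by blast
qed

text \<open>Vectors with the same proper support are not adjacent, so no neighbourhood contains the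
  other vector. Conversely, a vector whose support is the complement of that of \<open>v\<close> is
  adjacent to \<open>v\<close>, hence to \<open>u\<close>, and this forces the support of
  \<open>u\<close> to contain that of \<open>v\<close>. A vector of full support is adjacent to
  every other vertex, but no vertex is its own neighbour, so its class is a singleton.\<close>

lemma nbhd_rel_component_union_graph_iff:
  assumes "a \<noteq> 0" "b \<noteq> 0"
  shows "(a, b) \<in> nbhd_rel (component_union_graph scale Basis) \<longleftrightarrow>
    a = b \<or> basis_support scale Basis a \<noteq> Basis \<and>
      basis_support scale Basis a = basis_support scale Basis b"
proof
  assume "a = b \<or> basis_support scale Basis a \<noteq> Basis \<and>
      basis_support scale Basis a = basis_support scale Basis b"
  then show "(a, b) \<in> nbhd_rel (component_union_graph scale Basis)"
    using assms by (auto simp: nbhd_rel_def nbhd_def adj_component_union_graph)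
next
  let ?supp = "basis_support scale Basis"
  assume ab: "(a, b) \<in> nbhd_rel (component_union_graph scale Basis)"
  have nb: "u \<noteq> c \<and> ?supp u \<union> ?supp c = Basis \<longleftrightarrow> v \<noteq> c \<and> ?supp v \<union> ?supp c = Basis"
    if "(u, v) \<in> nbhd_rel (component_union_graph scale Basis)" "c \<noteq> 0" for u v c
  proof -
    let ?N = "nbhd (component_union_graph scale Basis)"
    have "u \<noteq> 0" "v \<noteq> 0" "c \<in> ?N u \<longleftrightarrow> c \<in> ?N v"
      using that(1) by (auto simp: nbhd_rel_def)
    then show ?thesis
      using that(2) by (simp add: nbhd_def adj_component_union_graph)
  qed
  have ba: "(b, a) \<in> nbhd_rel (component_union_graph scale Basis)"
    using ab by (auto simp: nbhd_rel_def)
  have sub: "?supp v \<subseteq> ?supp u"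
    if uv: "(u, v) \<in> nbhd_rel (component_union_graph scale Basis)" and u: "?supp u \<noteq> Basis"
      and v: "v \<noteq> 0" for u v
  proof -
    obtain c where c: "?supp c = Basis - ?supp v" using ex_basis_support by (metis Diff_subset)
    show ?thesis
    proof (cases "c = 0")
      \<comment> \<open>The test vector is no vertex here: \<open>v\<close> has full support. If
        \<open>u\<close> and \<open>v\<close> differed, \<open>u\<close> would be a neighbour of
        \<open>v\<close> and thus of itself.\<close>
      case True
      then have "?supp v = Basis"
        using c basis_support_empty_iff[of c] basis_support_subset[of scale Basis v] by auto
      moreover have "u \<noteq> 0" using uv by (auto simp: nbhd_rel_def)
      ultimately have "u = v"
        using nb[OF uv \<open>u \<noteq> 0\<close>] basis_support_subset[of scale Basis u] by auto
      then show ?thesis by simp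
    next
      case False
      have "v \<noteq> c"
        using c v basis_support_empty_iff[of v] basis_support_subset[of scale Basis v] by auto
      then have "?supp u \<union> ?supp c = Basis"
        using nb[OF uv False] c basis_support_subset[of scale Basis v] by auto
      then show ?thesis using c basis_support_subset[of scale Basis v] by auto
    qed
  qed
  have full: "u = v"
    if uv: "(u, v) \<in> nbhd_rel (component_union_graph scale Basis)" and u: "?supp u = Basis"
      and v: "v \<noteq> 0" for u v
    using nb[OF uv v] u basis_support_subset[of scale Basis v] by auto
  show "a = b \<or> ?supp a \<noteq> Basis \<and> ?supp a = ?supp b"
    using full[OF ab _ assms(2)] full[OF ba _ assms(1)] sub[OF ab _ assms(2)] sub[OF ba _ assms(1)]
    by blast
qed

end

text \<open>Supplies the premise \<open>irrefl\<close> of \<open>graph_iso_quotientI\<close> for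
  both target graphs.\<close>

lemma adj_join_complete_irrefl:
  assumes "simple_graph G"
  shows "\<not> adj (join_graph G (complete_graph r)) x x"
  using simple_graph_adjD(3)[OF assms] by (cases x) (auto simp: adj_complete_graph)

section \<open>The two isomorphisms and the number of vectors of full support\<close>

theorem corollary3p9:
  fixes scale :: "'f::field \<Rightarrow> 'v::ab_group_add \<Rightarrow> 'v"
    and B :: "'v set" and n :: nat
  assumes "n \<ge> 1"
    and "finite_dimensional_vector_space scale B"
    and "card B = n"
  shows "graph_iso (reduced_graph (component_graph scale B))
           (join_graph (complement_graph (zero_divisor_graph (Z2_power n))) (complete_graph cone))
       \<and> graph_iso (nbhd_quotient_graph (component_union_graph scale B))
           (join_graph (zero_divisor_graph (Z2_power n)) (complete_graph |full_vectors scale B| ))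
       \<and> |full_vectors scale B| =o |UNIV - {0::'f}| ^c |{1..n}|
       \<and> (finite (UNIV :: 'f set) \<longrightarrow> card (full_vectors scale B) = (card (UNIV :: 'f set) - 1) ^ n)"
proof -
  interpret finite_dimensional_vector_space scale B by fact
  let ?supp = "basis_support scale B" and ?Z = "zero_divisor_graph (Z2_power n)"
  \<comment> \<open>A duplicate-free enumeration of the basis matches its vectors with the
    coordinates of \<open>Z2_power n\<close>.\<close>
  obtain bs where bs: "distinct bs" "set bs = B"
    using finite_distinct_list[OF finite_Basis] by blast
  then have n: "n = length bs" using assms(3) distinct_card[of bs] by simp
  \<comment> \<open>This uses \<open>n \<ge> 1\<close> and makes vectors of full support nonzero,
    hence vertices.\<close>
  have "B \<noteq> {}" using assms(1,3) by auto
  let ?w = "indicator_word bs"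
  note verts_Z = verts_zero_divisor_graph_Z2_power[OF bs(1), folded n, unfolded bs(2)]
  note adj_Z = adj_zero_divisor_graph_Z2_power[OF bs(1), folded n, unfolded bs(2)]
  have w_eq: "?w S = ?w T \<longleftrightarrow> S = T" if "S \<subseteq> B" "T \<subseteq> B" for S T
    using that bs(2) by (simp add: indicator_word_eq_iff Int_absorb2)
  note supp_sub = basis_support_subset[of scale B]
  have simple_Z: "simple_graph ?Z" "simple_graph (complement_graph ?Z)"
    by (simp_all add: zero_divisor_graph_def complement_graph_def simple_graph_graph_of)
  have "graph_iso (reduced_graph (component_graph scale B))
      (join_graph (complement_graph ?Z) (complete_graph cone))"
    unfolding reduced_graph_def
  proof (rule graph_iso_quotientI)
    \<comment> \<open>The cardinal \<open>cone\<close> lives on the unit type, so \<open>()\<close>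
      is the vertex of \<open>K\<^sub>1\<close>.\<close>
    let ?f = "\<lambda>a. if ?supp a = B then Inr () else Inl (?w (?supp a))"
    show "equiv (verts (component_graph scale B)) (red_rel (component_graph scale B))"
      by (rule equiv_red_rel) (simp add: component_graph_def simple_graph_graph_of)
    show "?f ` verts (component_graph scale B) =
        verts (join_graph (complement_graph ?Z) (complete_graph cone))" (is "?f ` ?V = ?W")
    proof
      show "?f ` ?V \<subseteq> ?W"
      proof (rule image_subsetI)
        fix a assume "a \<in> ?V"
        then show "?f a \<in> ?W"
          using supp_sub[of a]
          by (auto simp: verts_Z cone_def Field_card_of basis_support_empty_iff)
      qed
      show "?W \<subseteq> ?f ` ?V"
      proof
        fix y assume "y \<in> ?W"
        then consider "y = Inr ()" | S where "S \<subseteq> B" "S \<noteq> {}" "S \<noteq> B" "y = Inl (?w S)"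
          by (auto simp: verts_Z)
        then obtain S where S: "S \<subseteq> B" "S \<noteq> {}" "y = (if S = B then Inr () else Inl (?w S))"
          using \<open>B \<noteq> {}\<close> that[of B] by cases auto
        obtain a where "?supp a = S" using ex_basis_support[OF S(1)] by blast
        with S show "y \<in> ?f ` ?V"
          using basis_support_empty_iff by (intro image_eqI[of _ _ a]) auto
      qed
    qed
    show "(u, v) \<in> red_rel (component_graph scale B) \<longleftrightarrow> ?f u = ?f v"
      if "u \<in> verts (component_graph scale B)" "v \<in> verts (component_graph scale B)" for u v
      using that supp_sub by (auto simp: red_rel_component_graph_iff w_eq)
    show "adj (component_graph scale B) u v \<longleftrightarrow>
        adj (join_graph (complement_graph ?Z) (complete_graph cone)) (?f u) (?f v)"
      if "u \<in> verts (component_graph scale B)" "v \<in> verts (component_graph scale B)"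
        "?f u \<noteq> ?f v" for u v
    proof -
      have uv: "?supp u \<subseteq> B" "?supp v \<subseteq> B" "?supp u \<noteq> {}" "?supp v \<noteq> {}" "u \<noteq> 0" "v \<noteq> 0" "u \<noteq> v"
        using that supp_sub by (auto simp: basis_support_empty_iff)
      have in_Z: "?w (?supp x) \<in> verts ?Z" if "?supp x \<noteq> B" "x \<noteq> 0" for x
        using that supp_sub by (auto simp: verts_Z basis_support_empty_iff)
      have "?supp u \<noteq> ?supp v"
      proof
        assume eq: "?supp u = ?supp v"
        show False using that(3) unfolding eq by simp
      qed
      then have "adj (complement_graph ?Z) (?w (?supp u)) (?w (?supp v)) \<longleftrightarrow> ?supp u \<inter> ?supp v \<noteq> {}"
        if "?supp u \<noteq> B" "?supp v \<noteq> B"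
        using uv that in_Z by (simp add: adj_complement_graph adj_Z w_eq)
      \<comment> \<open>At most one of the supports is \<open>B\<close>; if one is, it meets the
        other because that one is nonempty, which matches the edges across the join.\<close>
      then show ?thesis
        using uv \<open>?supp u \<noteq> ?supp v\<close> in_Z[of u] in_Z[of v]
        by (auto simp: adj_component_graph cone_def Field_card_of)
    qed
  qed (use simple_Z adj_join_complete_irrefl in blast)
  moreover have "graph_iso (nbhd_quotient_graph (component_union_graph scale B))
      (join_graph ?Z (complete_graph |full_vectors scale B| ))"
    unfolding nbhd_quotient_graph_def
  proof (rule graph_iso_quotientI)
    \<comment> \<open>Vectors of full support form singleton classes and are themselves the vertices
      of the complete graph. All others are sent to the word of the complement of their
      support.\<close>
    let ?f = "\<lambda>a. if ?supp a = B then Inr a else Inl (?w (B - ?supp a))"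
    have co_eq: "?w (B - ?supp u) = ?w (B - ?supp v) \<longleftrightarrow> ?supp u = ?supp v" for u v
      using supp_sub[of u] supp_sub[of v] by (auto simp: w_eq)
    have co_proper: "B - ?supp a \<noteq> B" if "a \<noteq> 0" for a
      using that supp_sub[of a] basis_support_empty_iff[of a] by blast
    show "equiv (verts (component_union_graph scale B)) (nbhd_rel (component_union_graph scale B))"
      by (rule equiv_nbhd_rel)
    show "?f ` verts (component_union_graph scale B) =
        verts (join_graph ?Z (complete_graph |full_vectors scale B| ))" (is "?f ` ?V = ?W")
    proof
      show "?f ` ?V \<subseteq> ?W"
      proof (rule image_subsetI)
        fix a assume "a \<in> ?V"
        then show "?f a \<in> ?W"
          using supp_sub[of a] co_proper[of a]
          by (auto simp: verts_Z Field_card_of basis_support_empty_iff full_vectors_iff)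
      qed
      show "?W \<subseteq> ?f ` ?V"
      proof
        fix y assume "y \<in> ?W"
        then consider a where "?supp a = B" "y = Inr a"
          | S where "S \<subseteq> B" "S \<noteq> {}" "S \<noteq> B" "y = Inl (?w S)"
          by (auto simp: verts_Z Field_card_of full_vectors_iff)
        then show "y \<in> ?f ` ?V"
        proof cases
          case 1
          then show ?thesis
            using basis_support_empty_iff \<open>B \<noteq> {}\<close> by (intro image_eqI[of _ _ a]) auto
        next
          case 2
          \<comment> \<open>Complementing twice returns \<open>S\<close>; as \<open>S\<close> is
            proper, \<open>a\<close> is nonzero.\<close>
          obtain a where "?supp a = B - S" using ex_basis_support[of "B - S"] by blast
          with 2 show ?thesis
            using basis_support_empty_iff[of a]
            by (intro image_eqI[of _ _ a]) (auto simp: double_diff)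
        qed
      qed
    qed
    show "(u, v) \<in> nbhd_rel (component_union_graph scale B) \<longleftrightarrow> ?f u = ?f v"
      if "u \<in> verts (component_union_graph scale B)" "v \<in> verts (component_union_graph scale B)"
      for u v
      using that by (auto simp: nbhd_rel_component_union_graph_iff co_eq)
    show "adj (component_union_graph scale B) u v \<longleftrightarrow>
        adj (join_graph ?Z (complete_graph |full_vectors scale B| )) (?f u) (?f v)"
      if "u \<in> verts (component_union_graph scale B)" "v \<in> verts (component_union_graph scale B)"
        "?f u \<noteq> ?f v" for u v
    proof -
      have uv: "?supp u \<subseteq> B" "?supp v \<subseteq> B" "?supp u \<noteq> {}" "?supp v \<noteq> {}" "u \<noteq> 0" "v \<noteq> 0" "u \<noteq> v"
        using that supp_sub by (auto simp: basis_support_empty_iff)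
      have in_Z: "?w (B - ?supp x) \<in> verts ?Z" if "?supp x \<noteq> B" "x \<noteq> 0" for x
        using that supp_sub[of x] co_proper[of x] by (auto simp: verts_Z)
      \<comment> \<open>De Morgan: the complements are disjoint exactly if the supports cover
        \<open>B\<close>.\<close>
      have "adj ?Z (?w (B - ?supp u)) (?w (B - ?supp v)) \<longleftrightarrow> ?supp u \<union> ?supp v = B"
        if "?supp u \<noteq> B" "?supp v \<noteq> B"
        using uv that by (subst adj_Z) auto
      then show ?thesis
        using uv in_Z[of u] in_Z[of v]
        by (auto simp: adj_component_union_graph adj_complete_graph Field_card_of full_vectors_iff)
    qed
  qed (use simple_Z adj_join_complete_irrefl in blast)
  moreover have "|full_vectors scale B| =o |UNIV - {0::'f}| ^c |{1..n}|"
  proof -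
    \<comment> \<open>It remains to replace the exponent \<open>|B|\<close> by the equal cardinal
      \<open>|{1..n}|\<close>.\<close>
    have "|B| =o |{1..n}|"
      using finite_same_card_bij[OF finite_Basis, of "{1..n}"] assms(3)
      by (auto simp: card_of_ordIso[symmetric])
    then show ?thesis
      by (rule ordIso_transitive[OF full_vectors_ordIso cexp_cong2[OF _ card_of_Card_order card_of_Card_order]])
  qed
  moreover have "card (full_vectors scale B) = (card (UNIV :: 'f set) - 1) ^ n"
    if "finite (UNIV :: 'f set)"
    using card_full_vectors[OF that] assms(3) by simp
  ultimately show ?thesis by blast
qed

end
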